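(* Fix $k\ge 1$. For any sequence of finite subsets $V_1^k,V_2^k,\dots$ of $\mathbb{Z}_{>0}$ with $\lambda(V_n^k)=\lambda_k^{(n)}$ for all $n\geq 1$, where $\lambda_k^{(n)}=(nk,(n-1)k,\dots,k)$, we have $$\sum_{n\geq 1}\chi_{\Pi_{\Gamma_{V_n^k}}}(t)\,u^n = \sum_{n\geq 1} \frac{(t-1)_{n-1}\left((t-1)_{n}\right)^k u^{n}}{\prod_{i=1}^{n}\left(1-i(t-i)^{k}u\right)},$$ where $(x)_n = x(x-1)\cdots(x-(n-1))$.
   Context: The identity is one of formal power series in $u$ with coefficients in $\mathbb{Z}[t]$; $(x)_0=1$. For a finite subset $V$ of $\mathbb{Z}_{>0}$, $\Gamma_V$ is the graph with vertex set $V$ and with an edge $\{2i-1,2j\}$ for each odd $2i-1\in V$ and even $2j\in V$ with $2i-1<2j$ (and no other edges). The partition type $\lambda(V)$: if the odd elements of $V$ are $2i_1-1<\cdots<2i_p-1$ and the even elements are $2j_1<\cdots<2j_q$, put $\lambda_b=\#\{a : 2i_a-1<2j_b\}$ for $1\le b\le q$; then $\lambda(V)=(\lambda_q,\dots,\lambda_1)$. The bond lattice $\Pi_G$ of a finite graph $G$ is the poset, ordered by refinement, of set partitions of the vertex set of $G$ each of whose blocks induces a connected subgraph. For a finite ranked poset $P$ with bottom $\hat 0$, the characteristic polynomial is $\chi_P(t)=\sum_{X\in P}\mu_P(\hat 0,X)\,t^{\mathrm{rk}(P)-\mathrm{rk}(X)}$, where $\mu_P$ is the Möbius function and $\mathrm{rk}(P)$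 is the length of $P$. *)

theory Defs
  imports
    "HOL-Analysis.Infinite_Sum"
    "HOL-Computational_Algebra.Computational_Algebra"
    "HOL-Library.Disjoint_Sets"
begin

section \<open>Finite posets\<close>

text \<open>A poset is a carrier \<open>P\<close> with an order relation \<open>r\<close> such that \<^term>\<open>partial_order_on P r\<close>.\<close>

definition poset_bot :: "'a set \<Rightarrow> 'a rel \<Rightarrow> 'a" where
  "poset_bot P r = (THE b. b \<in> P \<and> (\<forall>x\<in>P. (b, x) \<in> r))"

text \<open>The length of a finite nonempty poset: a chain with \<open>l + 1\<close> elements has length \<open>l\<close>.\<close>

definition poset_length :: "'a set \<Rightarrow> 'a rel \<Rightarrow> nat" where
  "poset_length P r = Max {card C - 1 | C. C \<subseteq> P \<and> C \<noteq> {} \<and> C \<in> Chains r}"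

definition poset_rank :: "'a set \<Rightarrow> 'a rel \<Rightarrow> 'a \<Rightarrow> nat" where
  "poset_rank P r x = poset_length {y \<in> P. (y, x) \<in> r} r"

text \<open>The recursion is guarded so that it terminates; outside finite posets the value is \<open>0\<close>.
  For \<open>x \<in> P\<close>, \<open>y \<in> P\<close> with \<open>x\<close> not below \<open>y\<close> the sum is empty, so the value is \<open>0\<close> as well.\<close>

function moebius :: "'a set \<Rightarrow> 'a rel \<Rightarrow> 'a \<Rightarrow> 'a \<Rightarrow> int" where
  "moebius P r x y =
    (if finite P \<and> partial_order_on P r \<and> x \<in> P \<and> y \<in> P
     then if x = y then 1
          else - (\<Sum>z\<in>{z\<in>P. (x, z) \<in> r \<and> (z, y) \<in> r \<and> z \<noteq> y}. moebius P r x z)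
     else 0)"
  by pat_completeness auto
termination
proof (relation "Wellfounded.measure (\<lambda>(P, r, x, y). card {z \<in> P. (z, y) \<in> r})", goal_cases)
  case 1
  show ?case by simp
next
  case (2 P r x y z)
  from 2 have fin: "finite P" and po: "partial_order_on P r" by auto
  from po have tr: "trans r" and an: "antisym r" and re: "refl_on P r"
    by (auto simp: partial_order_on_def preorder_on_def)
  have "{w \<in> P. (w, z) \<in> r} \<subset> {w \<in> P. (w, y) \<in> r}"
  proof
    show "{w \<in> P. (w, z) \<in> r} \<subseteq> {w \<in> P. (w, y) \<in> r}"
      using 2 tr by (auto dest: transD)
    have "y \<in> {w \<in> P. (w, y) \<in> r}" using 2 re by (auto dest: refl_onD)
    moreover have "y \<notin> {w \<in> P. (w, z) \<in> r}" using 2 an by (auto dest: antisymD)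
    ultimately show "{w \<in> P. (w, z) \<in> r} \<noteq> {w \<in> P. (w, y) \<in> r}" by blast
  qed
  then show ?case using fin by (simp add: psubset_card_mono)
qed

declare moebius.simps [simp del]

definition char_poly_poset :: "'a set \<Rightarrow> 'a rel \<Rightarrow> int poly" where
  "char_poly_poset P r =
    (\<Sum>x\<in>P. monom (moebius P r (poset_bot P r) x) (poset_length P r - poset_rank P r x))"


section \<open>Bond lattices\<close>

text \<open>A simple graph is given by a vertex set and a set \<open>E\<close> of two-element edges.\<close>

definition induces_connected :: "'a set set \<Rightarrow> 'a set \<Rightarrow> bool" where
  "induces_connected E B \<longleftrightarrow>
    B \<noteq> {} \<and> (\<forall>x\<in>B. \<forall>y\<in>B. (x, y) \<in> {(a, b). a \<in> B \<and> b \<in> B \<and> {a, b} \<in> E}\<^sup>*)"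

definition bond_lattice :: "'a set \<Rightarrow> 'a set set \<Rightarrow> 'a set set set" where
  "bond_lattice V E = {X. partition_on V X \<and> (\<forall>B\<in>X. induces_connected E B)}"

definition bond_order :: "'a set \<Rightarrow> 'a set set \<Rightarrow> 'a set set rel" where
  "bond_order V E = {(X, Y). X \<in> bond_lattice V E \<and> Y \<in> bond_lattice V E \<and> refines V X Y}"

lemma partial_order_bond_order: "partial_order_on (bond_lattice V E) (bond_order V E)"
proof -
  have "refines V X Z" if "refines V X Y" "refines V Y Z" for X Y Z :: "'a set set"
    using that unfolding refines_def by (meson subset_trans)
  then show ?thesis
    unfolding partial_order_on_def preorder_on_def
    by (auto simp: bond_order_def bond_lattice_def refl_on_def trans_def antisym_def
        intro: refines_refl dest: refines_asym)
qed

definition bond_char_poly :: "'a set \<Rightarrow> 'a set set \<Rightarrow> int poly" where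
  "bond_char_poly V E = char_poly_poset (bond_lattice V E) (bond_order V E)"


section \<open>The graphs \<open>\<Gamma>\<^sub>V\<close> and the partition type\<close>

definition Gamma_edges :: "nat set \<Rightarrow> nat set set" where
  "Gamma_edges V = {{a, b} | a b. a \<in> V \<and> b \<in> V \<and> odd a \<and> even b \<and> a < b}"

definition partition_type :: "nat set \<Rightarrow> nat list" where
  "partition_type V =
    rev (map (\<lambda>b. card {a \<in> V. odd a \<and> a < b}) (sorted_list_of_set {b \<in> V. even b}))"

definition staircase :: "nat \<Rightarrow> nat \<Rightarrow> nat list" where
  "staircase k n = rev (map (\<lambda>i. i * k) [1..<Suc n])"


section \<open>Falling factorials and power series\<close>

definition falling_factorial :: "'a::comm_ring_1 \<Rightarrow> nat \<Rightarrow> 'a" where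
  "falling_factorial x n = (\<Prod>i<n. x - of_nat i)"

text \<open>The type \<^typ>\<open>int poly\<close> has no \<open>inverse\<close>, hence neither has \<^typ>\<open>int poly fps\<close>.
  The reciprocal of a series with constant coefficient \<open>1\<close> is obtained from the library's
  one-sided inverse with prescribed constant coefficient.\<close>

definition fps_recip :: "'a::comm_ring_1 fps \<Rightarrow> 'a fps" where
  "fps_recip f = fps_right_inverse f 1"

lemma fps_recip: "f * fps_recip f = 1" if "fps_nth f 0 = 1"
  using that unfolding fps_recip_def by (intro fps_right_inverse) simp

abbreviation tvar :: "int poly" where
  "tvar \<equiv> monom 1 1"

end

theory Submission
  imports Defs
begin

text \<open>The characteristic polynomial of the bond lattice of a graph \<open>G\<close> is its chromatic polynomial
  divided by a power of \<open>t\<close>, one factor for each component (Rota, Whitney). The graph \<open>\<Gamma>\<^sub>V\<close> is bipartite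
  and its edges are nested, so its chromatic polynomial can be counted by colouring the even vertices
  from the largest to the smallest and then each odd vertex independently.

  For the first point, let \<open>q\<close> be a natural number and \<open>c\<close> a colouring of \<open>V\<close> with \<open>q\<close> colours, proper or
  not. The components of the graph of monochromatic edges form an element \<open>K c\<close> of the bond lattice, and
  \<open>c\<close> is constant on the blocks of \<open>X\<close> exactly if \<open>X \<le> K c\<close>
  (\<open>constant_on_blocks_iff_refines\<close>). As \<open>q\<^bsup>card X\<^esup>\<close> counts the colourings that are
  constant on the blocks of \<open>X\<close>, exchanging two sums turns \<open>\<Sum>X. \<mu>(0, X) q\<^bsup>card X\<^esup>\<close> into the sum over all \<open>c\<close> of
  \<open>\<Sum>X \<le> K c. \<mu>(0, X)\<close>, with \<open>0\<close> the bottom of the lattice. The inner sum is \<open>1\<close> if \<open>c\<close> is proper and \<open>0\<close> otherwise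
  by the defining recursion of \<open>\<mu>\<close> (\<open>moebius_sum_counts_proper_colourings\<close>). The exponents of
  the characteristic polynomial are handled by \<open>bond_interval_length\<close>: the rank of \<open>X\<close> is
  \<open>card V - card X\<close>, because two blocks joined by an edge can be merged one pair at a time.

  For the second point, an odd vertex \<open>a\<close> is adjacent to the evens above it, which are the first few
  entries of the decreasing list of evens. If these carry \<open>d\<close> distinct colours, then \<open>a\<close> has
  \<open>q - d\<close> admissible colours. The staircase type says that for each \<open>m\<close> from \<open>1\<close> to \<open>n\<close>
  exactly \<open>k\<close> odd vertices see precisely the first \<open>m\<close> evens; any other odd vertex is isolated.
  Hence the number of proper colourings is, up to the factor from isolated vertices, the sum over all
  sequences of \<open>n\<close> colours of \<open>\<Prod>m=1..n. (q - d\<^sub>m)\<^sup>k\<close>, where \<open>d\<^sub>m\<close> counts the distinct colours among the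
  first \<open>m\<close> entries (\<open>card_proper_colourings\<close>). Let \<open>S n j\<close> be the part with exactly \<open>j\<close> colours in total.
  The last entry either repeats one of \<open>j\<close> colours or is one of \<open>q - (j - 1)\<close> new ones, so
  \<open>S (n+1) j = (q - j)\<^sup>k (j S n j + (q - j + 1) S n (j - 1))\<close>. For the generating functions
  \<open>A\<^sub>j = \<Sum>n. S n j u\<^sup>n\<close> this reads \<open>A\<^sub>j (1 - j (t - j)\<^sup>k u) = (t - j)\<^sup>k (t - j + 1) u A\<^bsub>j-1\<^esub>\<close>, and iterating
  it down to \<open>A\<^sub>0 = 1\<close> shows that for \<open>j \<ge> 1\<close> the series \<open>A\<^sub>j\<close> is \<open>t\<close> times the \<open>j\<close>-th summand of the theorem (\<open>colour_seq_fps_closed_form\<close>).\<close>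

section \<open>The Moebius function and the bottom of a finite poset\<close>

text \<open>For an element \<open>y\<close> other than the bottom this is the recursion that defines the Moebius
  function, with its last summand brought to the other side.\<close>

lemma moebius_sum_below:
  assumes fin: "finite P" and po: "partial_order_on P r"
    and b: "b \<in> P" "\<And>x. x \<in> P \<Longrightarrow> (b, x) \<in> r" and y: "y \<in> P"
  shows "(\<Sum>z\<in>{z\<in>P. (z, y) \<in> r}. moebius P r b z) = (if y = b then 1 else 0)"
proof -
  from po have re: "\<And>x. x \<in> P \<Longrightarrow> (x, x) \<in> r" and an: "antisym r"
    by (auto simp: partial_order_on_def preorder_on_def dest: refl_onD)
  have split: "{z\<in>P. (z, y) \<in> r} = insert y {z\<in>P. (b, z) \<in> r \<and> (z, y) \<in> r \<and> z \<noteq> y}"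
    using b re y by auto
  have "(\<Sum>z\<in>{z\<in>P. (z, y) \<in> r}. moebius P r b z)
      = moebius P r b y + (\<Sum>z\<in>{z\<in>P. (b, z) \<in> r \<and> (z, y) \<in> r \<and> z \<noteq> y}. moebius P r b z)"
    unfolding split using fin by simp
  also have "\<dots> = (if y = b then 1 else 0)"
  proof (cases "y = b")
    case True
    have "{z\<in>P. (b, z) \<in> r \<and> (z, y) \<in> r \<and> z \<noteq> y} = {}"
      using an True by (auto dest: antisymD)
    then show ?thesis
      using True b fin po by (simp only:) (simp add: moebius.simps)
  next
    case False
    then show ?thesis
      using b y fin po by (subst moebius.simps) auto
  qed
  finally show ?thesis .
qed

lemma poset_bot_eq:
  assumes po: "partial_order_on P r" and b: "b \<in> P" "\<And>x. x \<in> P \<Longrightarrow> (b, x) \<in> r"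
  shows "poset_bot P r = b"
  unfolding poset_bot_def
proof (rule the_equality)
  show "b \<in> P \<and> (\<forall>x\<in>P. (b, x) \<in> r)" using b by blast
next
  fix c assume "c \<in> P \<and> (\<forall>x\<in>P. (c, x) \<in> r)"
  then show "c = b" using b po
    by (auto simp: partial_order_on_def dest: antisymD)
qed

section \<open>Bond lattices and their rank function\<close>

text \<open>Sending each block to the block that contains it is a surjection from the finer partition to the
  coarser one; if it were injective, every block would equal its image.\<close>

lemma refines_strict_card:
  assumes V: "finite V" and le: "refines V X Y" and ne: "X \<noteq> Y"
  shows "card Y < card X"
proof -
  have X: "partition_on V X" and Y: "partition_on V Y" and sub: "\<forall>x\<in>X. \<exists>y\<in>Y. x \<subseteq> y"
    using le by (auto simp: refines_def)
  have finX: "finite X" using V X by (rule finite_elements)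
  from sub obtain f where f: "\<And>x. x \<in> X \<Longrightarrow> f x \<in> Y \<and> x \<subseteq> f x" by metis
  have disj: "y = y'" if "y \<in> Y" "y' \<in> Y" "v \<in> y" "v \<in> y'" for y y' v
    using that partition_onD2[OF Y] by (auto simp: disjoint_def)
  have surj: "f ` X = Y"
  proof
    show "f ` X \<subseteq> Y" using f by auto
    show "Y \<subseteq> f ` X"
    proof
      fix y assume y: "y \<in> Y"
      then obtain v where v: "v \<in> y" using partition_onD3[OF Y] by fastforce
      then have "v \<in> \<Union>X" using y partition_onD1[OF X] partition_onD1[OF Y] by auto
      then obtain x where x: "x \<in> X" "v \<in> x" by auto
      then have "f x = y" using f[of x] disj[of "f x" y v] y v by auto
      then show "y \<in> f ` X" using x by auto
    qed
  qed
  show ?thesis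
  proof (rule ccontr)
    assume "\<not> card Y < card X"
    then have "card X = card (f ` X)"
      using surj card_image_le[OF finX, of f] by simp
    then have inj: "inj_on f X" using finX by (simp add: eq_card_imp_inj_on)
    have "f x = x" if x: "x \<in> X" for x
    proof
      show "f x \<subseteq> x"
      proof
        fix v assume v: "v \<in> f x"
        then have "v \<in> \<Union>X" using f[OF x] partition_onD1[OF X] partition_onD1[OF Y] by auto
        then obtain x' where x': "x' \<in> X" "v \<in> x'" by auto
        then have "f x' = f x" using f[OF x'(1)] f[OF x] disj v by blast
        then show "v \<in> x" using inj x x' by (auto dest: inj_onD)
      qed
    qed (use f x in auto)
    then have "f ` X = X" by simp
    then show False using surj ne by simp
  qed
qed

definition adjacency :: "'a set set \<Rightarrow> 'a set \<Rightarrow> 'a rel" where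
  "adjacency E B = {(a, b). a \<in> B \<and> b \<in> B \<and> {a, b} \<in> E}"

lemma adjacency_iff [simp]: "(a, b) \<in> adjacency E B \<longleftrightarrow> a \<in> B \<and> b \<in> B \<and> {a, b} \<in> E"
  by (simp add: adjacency_def)

lemma induces_connected_iff:
  "induces_connected E B \<longleftrightarrow> B \<noteq> {} \<and> (\<forall>x\<in>B. \<forall>y\<in>B. (x, y) \<in> (adjacency E B)\<^sup>*)"
  by (simp add: induces_connected_def adjacency_def)

lemma sym_adjacency: "sym (adjacency E B)"
  by (auto simp: sym_def insert_commute)

lemma adjacency_rtrancl_mono: "B \<subseteq> C \<Longrightarrow> (adjacency E B)\<^sup>* \<subseteq> (adjacency E C)\<^sup>*"
  by (intro rtrancl_mono) auto

text \<open>Since adjacency is symmetric, it suffices to reach every vertex from one base point.\<close>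

lemma induces_connectedI:
  assumes x: "x \<in> B" and r: "\<And>y. y \<in> B \<Longrightarrow> (x, y) \<in> (adjacency E B)\<^sup>*"
  shows "induces_connected E B"
  unfolding induces_connected_iff
proof (intro conjI ballI)
  show "B \<noteq> {}" using x by auto
next
  fix y z assume "y \<in> B" "z \<in> B"
  then have "(x, y) \<in> (adjacency E B)\<^sup>*" "(x, z) \<in> (adjacency E B)\<^sup>*" using r by auto
  then show "(y, z) \<in> (adjacency E B)\<^sup>*"
    by (meson rtrancl_trans symD sym_rtrancl sym_adjacency)
qed

lemma induces_connected_Un:
  assumes B: "induces_connected E B" and C: "induces_connected E C"
    and e: "b \<in> B" "c \<in> C" "{b, c} \<in> E"
  shows "induces_connected E (B \<union> C)"
proof (rule induces_connectedI[of b])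
  show "b \<in> B \<union> C" using e by simp
next
  fix y assume "y \<in> B \<union> C"
  then consider "y \<in> B" | "y \<in> C" by auto
  then show "(b, y) \<in> (adjacency E (B \<union> C))\<^sup>*"
  proof cases
    case 1
    then have "(b, y) \<in> (adjacency E B)\<^sup>*" using B e by (auto simp: induces_connected_iff)
    then show ?thesis using adjacency_rtrancl_mono[of B "B \<union> C"] by blast
  next
    case 2
    have "(b, c) \<in> adjacency E (B \<union> C)" using e by simp
    moreover have "(c, y) \<in> (adjacency E C)\<^sup>*" using C e 2 by (auto simp: induces_connected_iff)
    then have "(c, y) \<in> (adjacency E (B \<union> C))\<^sup>*" using adjacency_rtrancl_mono[of C "B \<union> C"] by blast
    ultimately show ?thesis by (rule converse_rtrancl_into_rtrancl)
  qed
qed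

lemma rtrancl_leaves_set:
  assumes "(x, y) \<in> R\<^sup>*" and "x \<in> S" "y \<notin> S"
  obtains a b where "(a, b) \<in> R" "a \<in> S" "b \<notin> S"
  using assms by (induction rule: rtrancl_induct) auto

lemma finite_bond_lattice: "finite V \<Longrightarrow> finite (bond_lattice V E)"
  by (rule finite_subset[OF _ finitely_many_partition_on[of V]]) (auto simp: bond_lattice_def)

lemma singletons_bond_lattice: "(\<lambda>x. {x}) ` V \<in> bond_lattice V E"
  by (auto simp: bond_lattice_def partition_on_singletons induces_connected_iff)

lemma singletons_least: "X \<in> bond_lattice V E \<Longrightarrow> ((\<lambda>x. {x}) ` V, X) \<in> bond_order V E"
  using singletons_bond_lattice[of V E]
  by (auto simp: bond_order_def bond_lattice_def refines_def partition_on_def)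

text \<open>A block \<open>C\<close> of \<open>X\<close> that is not a block of \<open>Y\<close> is cut into several blocks of \<open>Y\<close>. Being connected, \<open>C\<close>
  contains an edge between two of them, and merging these two gives a bond partition that is still
  below \<open>X\<close>. This is what makes the bond lattice graded by the number of blocks.\<close>

lemma bond_cover_below:
  assumes V: "finite V" and le: "(Y, X) \<in> bond_order V E" and ne: "Y \<noteq> X"
  obtains Z where "(Y, Z) \<in> bond_order V E" "(Z, X) \<in> bond_order V E" "card Y = Suc (card Z)"
proof -
  from le have Y: "partition_on V Y" and X: "partition_on V X"
    and Yc: "\<And>B. B \<in> Y \<Longrightarrow> induces_connected E B" and Xc: "\<And>B. B \<in> X \<Longrightarrow> induces_connected E B"
    and sub: "\<And>B. B \<in> Y \<Longrightarrow> \<exists>C\<in>X. B \<subseteq> C"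
    by (auto simp: bond_order_def bond_lattice_def refines_def)
  have finY: "finite Y" using V Y by (rule finite_elements)
  have disjX: "y = y'" if "y \<in> X" "y' \<in> X" "v \<in> y" "v \<in> y'" for y y' v
    using that partition_onD2[OF X] by (auto simp: disjoint_def)
  have disjY: "y = y'" if "y \<in> Y" "y' \<in> Y" "v \<in> y" "v \<in> y'" for y y' v
    using that partition_onD2[OF Y] by (auto simp: disjoint_def)
  have "\<not> Y \<subseteq> X"
  proof
    assume YX: "Y \<subseteq> X"
    have "X \<subseteq> Y"
    proof
      fix C assume C: "C \<in> X"
      then obtain v where v: "v \<in> C" using partition_onD3[OF X] by fastforce
      then have "v \<in> \<Union>Y" using C partition_onD1[OF X] partition_onD1[OF Y] by auto
      then obtain B where "B \<in> Y" "v \<in> B" by auto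
      then show "C \<in> Y" using disjX[of B C v] C v YX by auto
    qed
    then show False using YX ne by simp
  qed
  then obtain B where B: "B \<in> Y" "B \<notin> X" by auto
  then obtain C where C: "C \<in> X" "B \<subseteq> C" using sub by auto
  then have "B \<subset> C" using B by auto
  then obtain v where v: "v \<in> C" "v \<notin> B" by auto
  \<comment> \<open>A path inside \<open>C\<close> from \<open>B\<close> to a vertex outside \<open>B\<close> supplies the edge along which to merge.\<close>
  obtain w where w: "w \<in> B" using partition_onD3[OF Y] B by fastforce
  have "(w, v) \<in> (adjacency E C)\<^sup>*" using Xc[OF C(1)] w v C by (auto simp: induces_connected_iff)
  then obtain a b where ab: "(a, b) \<in> adjacency E C" "a \<in> B" "b \<notin> B"
    using rtrancl_leaves_set[of w v "adjacency E C" B] w v by blast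
  have "b \<in> \<Union>Y" using ab C partition_onD1[OF X] partition_onD1[OF Y] by auto
  then obtain D where D: "D \<in> Y" "b \<in> D" by auto
  have BD: "B \<noteq> D" using ab D by auto
  have DC: "D \<subseteq> C"
  proof -
    obtain C' where C': "C' \<in> X" "D \<subseteq> C'" using sub[OF D(1)] by auto
    then have "C' = C" using disjX[of C' C b] C D ab by auto
    then show ?thesis using C' by simp
  qed
  define Z where "Z = insert (B \<union> D) (Y - {B, D})"
  have Zp: "partition_on V Z"
  proof (rule partition_onI)
    show "\<Union>Z = V" using B D partition_onD1[OF Y] by (auto simp: Z_def)
  next
    show "{} \<notin> Z" using partition_onD3[OF Y] w by (auto simp: Z_def)
  next
    fix p q assume "p \<in> Z" "q \<in> Z" "p \<noteq> q"
    then show "disjnt p q"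
      using disjY B D by (auto simp: Z_def disjnt_def)
  qed
  have Zb: "Z \<in> bond_lattice V E"
    using Zp Yc induces_connected_Un[OF Yc[OF B(1)] Yc[OF D(1)], of a b] ab D
    by (auto simp: bond_lattice_def Z_def)
  have "refines V Y Z" using Y Zp by (auto simp: refines_def Z_def)
  moreover have "refines V Z X"
    using X Zp sub C DC by (auto simp: refines_def Z_def)
  moreover have "card Y = Suc (card Z)"
  proof -
    have "B \<union> D \<notin> Y - {B, D}"
    proof
      assume "B \<union> D \<in> Y - {B, D}"
      then have "B \<union> D = B" using disjY[of "B \<union> D" B w] B w by blast
      then show False using ab D by auto
    qed
    then have "card Z = Suc (card (Y - {B, D}))" using finY by (simp add: Z_def)
    also have "card (Y - {B, D}) = card Y - 2"
      using finY B D BD by (subst card_Diff_subset) auto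
    moreover have "2 \<le> card Y" 
      using card_mono[OF finY, of "{B, D}"] B D BD by simp
    ultimately show ?thesis by simp
  qed
  ultimately show ?thesis using that Zb le by (auto simp: bond_order_def)
qed

lemma bond_saturated_chain:
  assumes V: "finite V" and le: "(Y, X) \<in> bond_order V E"
  shows "\<exists>C. C \<subseteq> {Z. (Y, Z) \<in> bond_order V E \<and> (Z, X) \<in> bond_order V E} \<and> C \<in> Chains (bond_order V E)
    \<and> finite C \<and> card C = Suc (card Y - card X)"
  using le
proof (induction "card Y" arbitrary: Y rule: less_induct)
  case less
  have po: "partial_order_on (bond_lattice V E) (bond_order V E)" by (rule partial_order_bond_order)
  then have tr: "trans (bond_order V E)" and an: "antisym (bond_order V E)"
    by (auto simp: partial_order_on_def preorder_on_def)
  have re: "(Z, Z) \<in> bond_order V E" if "Z \<in> bond_lattice V E" for Z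
    using that po by (auto simp: partial_order_on_def preorder_on_def dest: refl_onD)
  have inb: "Y \<in> bond_lattice V E" "X \<in> bond_lattice V E" using less.prems by (auto simp: bond_order_def)
  show ?case
  proof (cases "Y = X")
    case True
    then show ?thesis using re inb by (intro exI[of _ "{X}"]) (auto simp: Chains_def)
  next
    case False
    then obtain Z where Z: "(Y, Z) \<in> bond_order V E" "(Z, X) \<in> bond_order V E" "card Y = Suc (card Z)"
      using bond_cover_below[OF V less.prems] by blast
    then obtain C where C: "C \<subseteq> {W. (Z, W) \<in> bond_order V E \<and> (W, X) \<in> bond_order V E}"
      "C \<in> Chains (bond_order V E)" "finite C" "card C = Suc (card Z - card X)"
      using less.hyps[of Z] by auto
    have ZX: "card X \<le> card Z"
      using refines_strict_card[OF V, of Z X] Z by (cases "Z = X") (auto simp: bond_order_def)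
    have Yne: "Y \<noteq> Z" using Z by auto
    have "Y \<notin> C" using C(1) Z(1) an Yne by (auto dest: antisymD)
    moreover have "insert Y C \<in> Chains (bond_order V E)"
      using C(1,2) Z(1) tr re inb by (fastforce simp: Chains_def dest: transD)
    ultimately show ?thesis
      using C Z ZX less.prems re inb tr
      by (intro exI[of _ "insert Y C"]) (auto dest: transD)
  qed
qed

text \<open>A chain cannot repeat a number of blocks, and all these numbers lie between \<open>card X\<close> and \<open>card V\<close>; a
  saturated chain from the partition into singletons attains the bound.\<close>

lemma bond_interval_length:
  assumes V: "finite V" and X: "X \<in> bond_lattice V E"
  shows "poset_length {Y \<in> bond_lattice V E. (Y, X) \<in> bond_order V E} (bond_order V E) = card V - card X"
proof -
  let ?r = "bond_order V E" and ?D = "{Y \<in> bond_lattice V E. (Y, X) \<in> bond_order V E}"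
  have finD: "finite ?D" using finite_bond_lattice[OF V, of E] by simp
  have le_V: "card Y \<le> card V" if "Y \<in> bond_lattice V E" for Y
  proof -
    have "card Y \<le> card ((\<lambda>x. {x}) ` V)"
      using refines_strict_card[OF V, of "(\<lambda>x. {x}) ` V" Y] singletons_least[OF that]
      by (cases "Y = (\<lambda>x. {x}) ` V") (auto simp: bond_order_def)
    also have "\<dots> = card V" by (intro card_image inj_onI) auto
    finally show ?thesis .
  qed
  have X_le: "card X \<le> card Y" if "(Y, X) \<in> ?r" for Y
    using refines_strict_card[OF V, of Y X] that by (cases "Y = X") (auto simp: bond_order_def)
  show ?thesis
    unfolding poset_length_def
  proof (rule Max_eqI)
    have "{card C - 1 | C. C \<subseteq> ?D \<and> C \<noteq> {} \<and> C \<in> Chains ?r} \<subseteq> (\<lambda>C. card C - 1) ` Pow ?D" by auto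
    then show "finite {card C - 1 | C. C \<subseteq> ?D \<and> C \<noteq> {} \<and> C \<in> Chains ?r}"
      using finD by (meson finite_Pow_iff finite_imageI finite_subset)
  next
    fix m assume "m \<in> {card C - 1 | C. C \<subseteq> ?D \<and> C \<noteq> {} \<and> C \<in> Chains ?r}"
    then obtain C where C: "m = card C - 1" "C \<subseteq> ?D" "C \<in> Chains ?r" by auto
    have "inj_on card C"
    proof (rule inj_onI, rule ccontr)
      fix Y Z assume YZ: "Y \<in> C" "Z \<in> C" "card Y = card Z" "Y \<noteq> Z"
      then have "refines V Y Z \<or> refines V Z Y" using C(3) by (auto simp: Chains_def bond_order_def)
      then show False using refines_strict_card[OF V] YZ by fastforce
    qed
    then have "card C = card (card ` C)" by (simp add: card_image)
    also have "\<dots> \<le> card {card X..card V}"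
      using C(2) le_V X_le by (intro card_mono) auto
    finally show "m \<le> card V - card X" using C(1) by simp
  next
    have "((\<lambda>x. {x}) ` V, X) \<in> ?r" by (rule singletons_least[OF X])
    from bond_saturated_chain[OF V this] obtain C where
      C: "C \<subseteq> {Z. (Z, X) \<in> ?r}" "C \<in> Chains ?r" "card C = Suc (card ((\<lambda>x. {x}) ` V) - card X)"
      by blast
    moreover have "card ((\<lambda>x. {x}) ` V) = card V" by (intro card_image inj_onI) auto
    moreover have "C \<subseteq> ?D" using C(1) by (auto simp: bond_order_def)
    ultimately show "card V - card X \<in> {card C - 1 | C. C \<subseteq> ?D \<and> C \<noteq> {} \<and> C \<in> Chains ?r}"
      by (auto intro!: exI[of _ C])
  qed
qed

text \<open>The exponent \<open>rk(P) - rk(X)\<close> is \<open>card X - card T\<close> for the top element \<open>T\<close>, whose blocks are the components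
  of the graph. The power of \<open>t\<close> in front removes the dependence on \<open>T\<close> and leaves one factor \<open>t\<close> per
  block of \<open>X\<close>.\<close>

lemma bond_char_poly_times_monom:
  assumes V: "finite V" and T: "T \<in> bond_lattice V E"
    and top: "\<And>X. X \<in> bond_lattice V E \<Longrightarrow> (X, T) \<in> bond_order V E"
  shows "monom 1 (card T) * bond_char_poly V E =
    (\<Sum>X\<in>bond_lattice V E. monom (moebius (bond_lattice V E) (bond_order V E) ((\<lambda>x. {x}) ` V) X) (card X))"
proof -
  let ?P = "bond_lattice V E" and ?r = "bond_order V E" and ?b = "(\<lambda>x. {x}) ` V"
  have bot: "poset_bot ?P ?r = ?b"
    by (rule poset_bot_eq[OF partial_order_bond_order singletons_bond_lattice singletons_least])
  have len: "poset_length ?P ?r = card V - card T"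
  proof -
    have "{Y \<in> ?P. (Y, T) \<in> ?r} = ?P" using top by auto
    then show ?thesis using bond_interval_length[OF V T] by simp
  qed
  have rank: "poset_rank ?P ?r X = card V - card X" if "X \<in> ?P" for X
    unfolding poset_rank_def by (rule bond_interval_length[OF V that])
  have exponent: "card T + (card V - card T - (card V - card X)) = card X" if X: "X \<in> ?P" for X
  proof -
    have "card T \<le> card X"
      using refines_strict_card[OF V, of X T] top[OF X] by (cases "X = T") (auto simp: bond_order_def)
    moreover have "card X \<le> card ?b"
      using refines_strict_card[OF V, of ?b X] singletons_least[OF X]
      by (cases "X = ?b") (auto simp: bond_order_def)
    moreover have "card ?b = card V" by (intro card_image inj_onI) auto
    ultimately show ?thesis by simp
  qed
  show ?thesis
    unfolding bond_char_poly_def char_poly_poset_def sum_distrib_left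
    using exponent by (intro sum.cong refl) (simp add: mult_monom bot len rank del: diff_diff_left)
qed

section \<open>The bond lattice counts proper colourings\<close>

definition reachability :: "'a set set \<Rightarrow> 'a set \<Rightarrow> 'a rel" where
  "reachability F V = (adjacency F V)\<^sup>* \<inter> V \<times> V"

definition components :: "'a set set \<Rightarrow> 'a set \<Rightarrow> 'a set set" where
  "components F V = V // reachability F V"

lemma equiv_reachability: "equiv V (reachability F V)"
proof (rule equivI)
  show "reachability F V \<subseteq> V \<times> V" by (auto simp: reachability_def)
  show "refl_on V (reachability F V)" by (auto simp: reachability_def refl_on_def)
  have "sym ((adjacency F V)\<^sup>*)" by (intro sym_rtrancl sym_adjacency)
  then show "sym (reachability F V)" unfolding reachability_def by (auto simp: sym_def)
  show "trans (reachability F V)"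
    unfolding reachability_def by (auto intro!: transI dest: rtrancl_trans)
qed

text \<open>A walk along edges of \<open>F\<close> never leaves the component in which it starts, so it is also a walk in the
  subgraph of \<open>E\<close> induced on that component.\<close>

lemma components_connected:
  assumes FE: "F \<subseteq> E" and B: "B \<in> components F V"
  shows "induces_connected E B"
proof -
  obtain x where x: "x \<in> V" "B = reachability F V `` {x}"
    using B by (auto simp: components_def quotient_def)
  have "y \<in> B \<and> (x, y) \<in> (adjacency E B)\<^sup>*" if "(x, y) \<in> (adjacency F V)\<^sup>*" for y
    using that
  proof (induction rule: rtrancl_induct)
    case base
    then show ?case using x by (auto simp: reachability_def)
  next
    case (step y z)
    then have "z \<in> B" using x by (auto simp: reachability_def intro: rtrancl_into_rtrancl)
    moreover have "(y, z) \<in> adjacency E B" using step \<open>z \<in> B\<close> FE by auto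
    ultimately show ?case using step by (auto intro: rtrancl_into_rtrancl)
  qed
  moreover have "(x, y) \<in> (adjacency F V)\<^sup>*" if "y \<in> B" for y
    using that x by (auto simp: reachability_def)
  ultimately show ?thesis
    using x by (intro induces_connectedI[of x]) (auto simp: reachability_def)
qed

lemma components_bond_lattice: "F \<subseteq> E \<Longrightarrow> components F V \<in> bond_lattice V E"
  using partition_on_quotient[OF equiv_reachability, of V F] components_connected
  by (auto simp: bond_lattice_def components_def)

definition monochromatic :: "'a set set \<Rightarrow> ('a \<Rightarrow> 'b) \<Rightarrow> 'a set set" where
  "monochromatic E c = {e \<in> E. \<forall>x\<in>e. \<forall>y\<in>e. c x = c y}"

text \<open>The components of the graph of monochromatic edges are the coarsest bond partition on whose blocks
  \<open>c\<close> is constant: a connected block on which \<open>c\<close> is constant is connected by monochromatic edges, and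
  conversely the colour does not change along such edges.\<close>

lemma constant_on_blocks_iff_refines:
  assumes X: "X \<in> bond_lattice V E"
  shows "(\<forall>B\<in>X. \<forall>x\<in>B. \<forall>y\<in>B. c x = c y) \<longleftrightarrow> (X, components (monochromatic E c) V) \<in> bond_order V E"
    (is "?const \<longleftrightarrow> (X, ?K) \<in> _")
proof
  have K: "?K \<in> bond_lattice V E"
    by (rule components_bond_lattice) (auto simp: monochromatic_def)
  assume const: ?const
  have "\<exists>C\<in>?K. B \<subseteq> C" if B: "B \<in> X" for B
  proof -
    have BV: "B \<subseteq> V" and con: "induces_connected E B"
      using X B by (auto simp: bond_lattice_def partition_on_def)
    then obtain x where x: "x \<in> B" by (auto simp: induces_connected_iff)
    have "adjacency E B \<subseteq> adjacency (monochromatic E c) V"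
      using const B BV by (auto simp: monochromatic_def)
    then have "(adjacency E B)\<^sup>* \<subseteq> (adjacency (monochromatic E c) V)\<^sup>*" by (rule rtrancl_mono)
    then have "B \<subseteq> reachability (monochromatic E c) V `` {x}"
      using con x BV by (auto simp: induces_connected_iff reachability_def)
    moreover have "reachability (monochromatic E c) V `` {x} \<in> ?K"
      using x BV by (auto simp: components_def quotient_def)
    ultimately show ?thesis by blast
  qed
  then show "(X, ?K) \<in> bond_order V E"
    using X K by (auto simp: bond_order_def bond_lattice_def refines_def)
next
  assume le: "(X, ?K) \<in> bond_order V E"
  have eq: "c x = c y" if "(x, y) \<in> (adjacency (monochromatic E c) V)\<^sup>*" for x y
    using that
  proof (induction rule: rtrancl_induct)
    case (step y z)
    then have "c y = c z" unfolding adjacency_iff monochromatic_def by blast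
    with step.IH show ?case by (rule trans)
  qed simp
  show ?const
  proof (intro ballI)
    fix B x y assume "B \<in> X" "x \<in> B" "y \<in> B"
    moreover obtain C where "C \<in> ?K" "B \<subseteq> C"
      using le \<open>B \<in> X\<close> unfolding bond_order_def refines_def by blast
    ultimately have "C \<in> ?K" "x \<in> C" "y \<in> C" by auto
    then have "(x, y) \<in> reachability (monochromatic E c) V"
      unfolding components_def by (meson equiv_reachability quotient_eq_iff)
    then show "c x = c y" using eq by (simp add: reachability_def)
  qed
qed

definition proper_colouring :: "'a set \<Rightarrow> 'a set set \<Rightarrow> ('a \<Rightarrow> 'b) \<Rightarrow> bool" where
  "proper_colouring V E c \<longleftrightarrow> (\<forall>a\<in>V. \<forall>b\<in>V. {a, b} \<in> E \<longrightarrow> c a \<noteq> c b)"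

lemma proper_iff_components_singletons:
  assumes loopfree: "\<And>a. {a} \<notin> E"
  shows "proper_colouring V E c \<longleftrightarrow> components (monochromatic E c) V = (\<lambda>x. {x}) ` V"
    (is "_ \<longleftrightarrow> ?K = _")
proof
  assume "proper_colouring V E c"
  then have "adjacency (monochromatic E c) V = {}"
    by (auto simp: proper_colouring_def monochromatic_def adjacency_def)
  then have "reachability (monochromatic E c) V = Id_on V"
    by (auto simp: reachability_def)
  then show "?K = (\<lambda>x. {x}) ` V"
    by (auto simp: components_def quotient_def)
next
  assume K: "?K = (\<lambda>x. {x}) ` V"
  show "proper_colouring V E c"
    unfolding proper_colouring_def
  proof (intro ballI impI notI)
    fix a b assume ab: "a \<in> V" "b \<in> V" "{a, b} \<in> E" "c a = c b"
    then have "(a, b) \<in> adjacency (monochromatic E c) V"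
      by (auto simp: monochromatic_def)
    then have "{a, b} \<subseteq> reachability (monochromatic E c) V `` {a}"
      using ab by (auto simp: reachability_def)
    moreover have "reachability (monochromatic E c) V `` {a} \<in> ?K"
      using ab by (auto simp: components_def quotient_def)
    ultimately have "a = b" using K by auto
    then show False using ab loopfree by auto
  qed
qed

lemma card_colourings_constant_on_blocks:
  assumes V: "finite V" and X: "partition_on V X" and Q: "finite Q"
  shows "card {c \<in> V \<rightarrow>\<^sub>E Q. \<forall>B\<in>X. \<forall>x\<in>B. \<forall>y\<in>B. c x = c y} = card Q ^ card X"
proof -
  define block where "block v = (THE B. B \<in> X \<and> v \<in> B)" for v
  define rep where "rep B = (SOME v. v \<in> B)" for B :: "'a set"
  have block: "block v = B" if "B \<in> X" "v \<in> B" for v B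
    unfolding block_def using that partition_onD2[OF X]
    by (intro the_equality) (auto simp: disjoint_def)
  have block_in: "block v \<in> X \<and> v \<in> block v" if v: "v \<in> V" for v
  proof -
    obtain B where "B \<in> X" "v \<in> B" using v partition_onD1[OF X] by blast
    then show ?thesis using block by simp
  qed
  have rep: "rep B \<in> B" if "B \<in> X" for B
    using that partition_onD3[OF X] unfolding rep_def by (metis some_in_eq)
  have sub: "B \<subseteq> V" if "B \<in> X" for B using that partition_onD1[OF X] by auto
  let ?A = "{c \<in> V \<rightarrow>\<^sub>E Q. \<forall>B\<in>X. \<forall>x\<in>B. \<forall>y\<in>B. c x = c y}"
  have "bij_betw (\<lambda>c. restrict (\<lambda>B. c (rep B)) X) ?A (X \<rightarrow>\<^sub>E Q)"
  proof (rule bij_betw_byWitness[where f' = "\<lambda>d. restrict (\<lambda>v. d (block v)) V"])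
    show "\<forall>c\<in>?A. restrict (\<lambda>v. restrict (\<lambda>B. c (rep B)) X (block v)) V = c"
    proof
      fix c assume c: "c \<in> ?A"
      show "restrict (\<lambda>v. restrict (\<lambda>B. c (rep B)) X (block v)) V = c"
      proof
        fix v
        show "restrict (\<lambda>v. restrict (\<lambda>B. c (rep B)) X (block v)) V v = c v"
        proof (cases "v \<in> V")
          case True
          then show ?thesis using c block_in[OF True] rep[of "block v"] by auto
        next
          case False
          then show ?thesis using c by (auto simp: PiE_def extensional_def)
        qed
      qed
    qed
    show "\<forall>d\<in>X \<rightarrow>\<^sub>E Q. restrict (\<lambda>B. restrict (\<lambda>v. d (block v)) V (rep B)) X = d"
    proof
      fix d assume d: "d \<in> X \<rightarrow>\<^sub>E Q"
      show "restrict (\<lambda>B. restrict (\<lambda>v. d (block v)) V (rep B)) X = d"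
      proof
        fix B
        show "restrict (\<lambda>B. restrict (\<lambda>v. d (block v)) V (rep B)) X B = d B"
          using d rep[of B] sub[of B] block[of B "rep B"] by (cases "B \<in> X") auto
      qed
    qed
    show "(\<lambda>c. restrict (\<lambda>B. c (rep B)) X) ` ?A \<subseteq> X \<rightarrow>\<^sub>E Q"
      using rep sub by fastforce
    show "(\<lambda>d. restrict (\<lambda>v. d (block v)) V) ` (X \<rightarrow>\<^sub>E Q) \<subseteq> ?A"
    proof
      fix c assume "c \<in> (\<lambda>d. restrict (\<lambda>v. d (block v)) V) ` (X \<rightarrow>\<^sub>E Q)"
      then obtain d where d: "d \<in> X \<rightarrow>\<^sub>E Q" and c: "c = restrict (\<lambda>v. d (block v)) V" by auto
      have "c \<in> V \<rightarrow>\<^sub>E Q" using d block_in unfolding c by auto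
      moreover have "c x = c y" if "B \<in> X" "x \<in> B" "y \<in> B" for B x y
        using block[OF that(1)] that sub[OF that(1)] by (auto simp: c)
      ultimately show "c \<in> ?A" by blast
    qed
  qed
  then have "card ?A = card (X \<rightarrow>\<^sub>E Q)" by (rule bij_betw_same_card)
  also have "\<dots> = card Q ^ card X"
    using finite_elements[OF V X] by (simp add: card_PiE)
  finally show ?thesis .
qed

text \<open>Write \<open>K c\<close> for the components of the monochromatic edges of \<open>c\<close>. Counting pairs of a bond partition \<open>X\<close>
  and a colouring \<open>c\<close> with \<open>X \<le> K c\<close>, weighted by the Moebius function at \<open>X\<close>, gives the left side when
  \<open>X\<close> is fixed first; when \<open>c\<close> is fixed first, only colourings for which \<open>K c\<close> is the bottom survive,
  and these are the proper ones.\<close>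

lemma moebius_sum_counts_proper_colourings:
  assumes V: "finite V" and loopfree: "\<And>a. {a} \<notin> E" and Q: "finite Q"
  shows "(\<Sum>X\<in>bond_lattice V E.
      moebius (bond_lattice V E) (bond_order V E) ((\<lambda>x. {x}) ` V) X * int (card Q) ^ card X)
    = int (card {c \<in> V \<rightarrow>\<^sub>E Q. proper_colouring V E c})"
proof -
  let ?P = "bond_lattice V E" and ?r = "bond_order V E" and ?b = "(\<lambda>x. {x}) ` V"
  let ?mu = "moebius ?P ?r ?b" and ?A = "V \<rightarrow>\<^sub>E Q"
  let ?K = "\<lambda>c. components (monochromatic E c) V"
  have finP: "finite ?P" by (rule finite_bond_lattice[OF V])
  have finA: "finite ?A" by (intro finite_PiE V Q)
  have count: "int (card Q) ^ card X = (\<Sum>c\<in>?A. if (X, ?K c) \<in> ?r then 1 else 0)" if X: "X \<in> ?P" for X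
  proof -
    have "partition_on V X" using X by (simp add: bond_lattice_def)
    then have "int (card Q) ^ card X = int (card {c \<in> ?A. \<forall>B\<in>X. \<forall>x\<in>B. \<forall>y\<in>B. c x = c y})"
      using card_colourings_constant_on_blocks[OF V _ Q] by simp
    also have "\<dots> = int (card {c \<in> ?A. (X, ?K c) \<in> ?r})"
      unfolding constant_on_blocks_iff_refines[OF X] ..
    also have "\<dots> = (\<Sum>c\<in>?A. if (X, ?K c) \<in> ?r then 1 else 0)"
      using finA by (simp add: sum.If_cases Int_def)
    finally show ?thesis .
  qed
  have "(\<Sum>X\<in>?P. ?mu X * int (card Q) ^ card X)
      = (\<Sum>X\<in>?P. \<Sum>c\<in>?A. ?mu X * (if (X, ?K c) \<in> ?r then 1 else 0))"
    by (intro sum.cong refl) (simp add: count sum_distrib_left)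
  also have "\<dots> = (\<Sum>c\<in>?A. \<Sum>X\<in>?P. ?mu X * (if (X, ?K c) \<in> ?r then 1 else 0))"
    by (rule sum.swap)
  also have "\<dots> = (\<Sum>c\<in>?A. if proper_colouring V E c then 1 else 0)"
  proof (intro sum.cong refl)
    fix c assume "c \<in> ?A"
    have K: "?K c \<in> ?P" by (rule components_bond_lattice) (auto simp: monochromatic_def)
    have "(\<Sum>X\<in>?P. ?mu X * (if (X, ?K c) \<in> ?r then 1 else 0)) = (\<Sum>X\<in>{X\<in>?P. (X, ?K c) \<in> ?r}. ?mu X)"
      using finP by (intro sum.mono_neutral_cong_right) auto
    also have "\<dots> = (if ?K c = ?b then 1 else 0)"
      by (rule moebius_sum_below[OF finP partial_order_bond_order singletons_bond_lattice singletons_least K])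
    finally show "(\<Sum>X\<in>?P. ?mu X * (if (X, ?K c) \<in> ?r then 1 else 0)) = (if proper_colouring V E c then 1 else 0)"
      by (simp add: proper_iff_components_singletons[OF loopfree])
  qed
  also have "\<dots> = int (card {c \<in> ?A. proper_colouring V E c})"
    using finA by (simp add: sum.If_cases Int_def)
  finally show ?thesis .
qed

lemma bond_char_poly_counts_colourings:
  assumes V: "finite V" and loopfree: "\<And>a. {a} \<notin> E" and Q: "finite Q"
    and T: "T \<in> bond_lattice V E" "\<And>X. X \<in> bond_lattice V E \<Longrightarrow> (X, T) \<in> bond_order V E"
  shows "int (card Q) ^ card T * poly (bond_char_poly V E) (int (card Q))
    = int (card {c \<in> V \<rightarrow>\<^sub>E Q. proper_colouring V E c})"
proof -
  have "int (card Q) ^ card T * poly (bond_char_poly V E) (int (card Q))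
      = poly (monom 1 (card T) * bond_char_poly V E) (int (card Q))"
    by (simp add: poly_monom)
  also have "\<dots> = (\<Sum>X\<in>bond_lattice V E.
      moebius (bond_lattice V E) (bond_order V E) ((\<lambda>x. {x}) ` V) X * int (card Q) ^ card X)"
    by (subst bond_char_poly_times_monom[OF V T]) (simp_all add: poly_sum poly_monom)
  also have "\<dots> = int (card {c \<in> V \<rightarrow>\<^sub>E Q. proper_colouring V E c})"
    by (rule moebius_sum_counts_proper_colourings[OF V loopfree Q])
  finally show ?thesis .
qed

section \<open>The graphs \<open>\<Gamma>\<^sub>V\<close>\<close>

lemma Gamma_edges_iff:
  "{x, y} \<in> Gamma_edges V \<longleftrightarrow> x \<in> V \<and> y \<in> V \<and> (odd x \<and> even y \<and> x < y \<or> odd y \<and> even x \<and> y < x)"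
  by (auto simp: Gamma_edges_def doubleton_eq_iff)

lemma Gamma_edges_loopfree: "{a} \<notin> Gamma_edges V"
  using Gamma_edges_iff[of a a V] by auto

definition isolated_odds :: "nat set \<Rightarrow> nat set" where
  "isolated_odds V = {a \<in> V. odd a \<and> (\<forall>b\<in>V. even b \<longrightarrow> \<not> a < b)}"

text \<open>The hypotheses give an even vertex \<open>b\<^sub>1\<close> and an odd vertex \<open>a\<^sub>0\<close> below all evens. The non-isolated
  vertices then form one component: \<open>a\<^sub>0\<close> is adjacent to every even, and the largest even is adjacent to
  every non-isolated odd. So \<open>T\<close> is the partition into components, which is the top of the bond
  lattice.\<close>

lemma Gamma_top:
  assumes V: "finite V" and ev: "b\<^sub>1 \<in> V" "even b\<^sub>1"
    and od: "a\<^sub>0 \<in> V" "odd a\<^sub>0" "\<And>b. b \<in> V \<Longrightarrow> even b \<Longrightarrow> a\<^sub>0 < b"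
  defines "T \<equiv> insert (V - isolated_odds V) ((\<lambda>x. {x}) ` isolated_odds V)"
  shows "T \<in> bond_lattice V (Gamma_edges V)"
    and "\<And>X. X \<in> bond_lattice V (Gamma_edges V) \<Longrightarrow> (X, T) \<in> bond_order V (Gamma_edges V)"
    and "card T = Suc (card (isolated_odds V))"
proof -
  let ?I = "isolated_odds V" and ?E = "Gamma_edges V"
  let ?K = "V - ?I"
  have IV: "?I \<subseteq> V" by (auto simp: isolated_odds_def)
  have b1K: "b\<^sub>1 \<in> ?K" and a0K: "a\<^sub>0 \<in> ?K" using ev od by (auto simp: isolated_odds_def)
  define b0 where "b0 = Max {b \<in> V. even b}"
  have "b0 \<in> {b \<in> V. even b}" unfolding b0_def using V ev by (intro Max_in) auto
  then have b0: "b0 \<in> V" "even b0" by auto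
  then have b0K: "b0 \<in> ?K" by (auto simp: isolated_odds_def)
  have b0_max: "b \<le> b0" if "b \<in> V" "even b" for b
    unfolding b0_def using that V by (intro Max_ge) auto
  have K: "induces_connected ?E ?K"
  proof (rule induces_connectedI[OF b0K])
    fix y assume y: "y \<in> ?K"
    show "(b0, y) \<in> (adjacency ?E ?K)\<^sup>*"
    proof (cases "even y")
      case True
      have "(b0, a\<^sub>0) \<in> adjacency ?E ?K" "(a\<^sub>0, y) \<in> adjacency ?E ?K"
        using True y b0 b0K a0K od by (auto simp: Gamma_edges_iff)
      then show ?thesis by (meson converse_rtrancl_into_rtrancl r_into_rtrancl)
    next
      case False
      then obtain b where "b \<in> V" "even b" "y < b" using y by (auto simp: isolated_odds_def)
      then have "y < b0" using b0_max[of b] by simp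
      then have "(b0, y) \<in> adjacency ?E ?K" using False y b0 b0K by (auto simp: Gamma_edges_iff)
      then show ?thesis by blast
    qed
  qed
  have Tp: "partition_on V T"
    unfolding partition_on_def T_def using IV b1K by (auto simp: disjoint_def)
  show T: "T \<in> bond_lattice V ?E"
    using Tp K by (auto simp: bond_lattice_def T_def induces_connected_iff)
  show "(X, T) \<in> bond_order V ?E" if X: "X \<in> bond_lattice V ?E" for X
  proof -
    have "\<exists>C\<in>T. B \<subseteq> C" if B: "B \<in> X" for B
    proof (cases "B \<inter> ?I = {}")
      case True
      have "B \<subseteq> V" using X B by (auto simp: bond_lattice_def partition_on_def)
      then show ?thesis using True by (auto simp: T_def)
    next
      case False
      then obtain a where a: "a \<in> B" "a \<in> ?I" by auto
      have con: "induces_connected ?E B" using X B by (auto simp: bond_lattice_def)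
      have "y = a" if y: "y \<in> B" for y
      proof (rule ccontr)
        assume "y \<noteq> a"
        have "(a, y) \<in> (adjacency ?E B)\<^sup>*" using con a y by (auto simp: induces_connected_iff)
        then obtain z where "(a, z) \<in> adjacency ?E B"
          using \<open>y \<noteq> a\<close> by (cases rule: converse_rtranclE) auto
        then show False using a by (auto simp: Gamma_edges_iff isolated_odds_def)
      qed
      then have "B \<subseteq> {a}" by auto
      then show ?thesis using a by (auto simp: T_def)
    qed
    then show ?thesis using X T by (auto simp: bond_order_def bond_lattice_def refines_def)
  qed
  have "?K \<notin> (\<lambda>x. {x}) ` ?I" using b1K by auto
  moreover have "card ((\<lambda>x. {x}) ` ?I) = card ?I" by (intro card_image inj_onI) auto
  ultimately show "card T = Suc (card ?I)"
    unfolding T_def using finite_subset[OF IV V] by simp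
qed

text \<open>No two odd vertices are adjacent. Once the evens are coloured by \<open>g\<close> (in any way, as they are not
  adjacent to each other either), the colours of the odd vertices are chosen independently.\<close>

lemma card_proper_colourings_Gamma:
  assumes V: "finite V" and Q: "finite Q"
  shows "card {c \<in> V \<rightarrow>\<^sub>E Q. proper_colouring V (Gamma_edges V) c}
    = (\<Sum>g\<in>{b\<in>V. even b} \<rightarrow>\<^sub>E Q. \<Prod>a\<in>{a\<in>V. odd a}. card (Q - g ` {b\<in>V. even b \<and> a < b}))"
proof -
  let ?E = "{b\<in>V. even b}" and ?O = "{a\<in>V. odd a}"
  let ?A = "{c \<in> V \<rightarrow>\<^sub>E Q. proper_colouring V (Gamma_edges V) c}"
  let ?B = "SIGMA g:?E \<rightarrow>\<^sub>E Q. \<Pi>\<^sub>E a\<in>?O. Q - g ` {b\<in>V. even b \<and> a < b}"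
  have proper: "proper_colouring V (Gamma_edges V) c \<longleftrightarrow>
      (\<forall>a\<in>V. \<forall>b\<in>V. odd a \<and> even b \<and> a < b \<longrightarrow> c a \<noteq> c b)" for c :: "nat \<Rightarrow> 'a"
    unfolding proper_colouring_def Gamma_edges_iff
    by (intro iffI ballI impI) (blast, metis)
  have "bij_betw (\<lambda>c. (restrict c ?E, restrict c ?O)) ?A ?B"
  proof (rule bij_betw_byWitness[where f' = "\<lambda>(g, h). restrict (\<lambda>x. if even x then g x else h x) V"])
    show "\<forall>c\<in>?A. (case (restrict c ?E, restrict c ?O) of (g, h) \<Rightarrow>
        restrict (\<lambda>x. if even x then g x else h x) V) = c"
      by (auto simp: fun_eq_iff PiE_def extensional_def split: if_splits)
    show "\<forall>p\<in>?B. (restrict (case p of (g, h) \<Rightarrow> restrict (\<lambda>x. if even x then g x else h x) V) ?E,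
        restrict (case p of (g, h) \<Rightarrow> restrict (\<lambda>x. if even x then g x else h x) V) ?O) = p"
      by (fastforce simp: fun_eq_iff PiE_def extensional_def split: if_splits)
    show "(\<lambda>c. (restrict c ?E, restrict c ?O)) ` ?A \<subseteq> ?B"
    proof
      fix p assume "p \<in> (\<lambda>c. (restrict c ?E, restrict c ?O)) ` ?A"
      then obtain c where c: "c \<in> V \<rightarrow>\<^sub>E Q" "p = (restrict c ?E, restrict c ?O)"
        and pr: "\<forall>a\<in>V. \<forall>b\<in>V. odd a \<and> even b \<and> a < b \<longrightarrow> c a \<noteq> c b"
        unfolding proper by blast
      have "c a \<in> Q - restrict c ?E ` {b\<in>V. even b \<and> a < b}" if "a \<in> ?O" for a
        using that c(1) pr by fastforce
      moreover have "restrict c ?E \<in> ?E \<rightarrow>\<^sub>E Q" using c(1) by auto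
      ultimately show "p \<in> ?B" unfolding c(2) by (simp add: restrict_PiE_iff)
    qed
    show "(\<lambda>(g, h). restrict (\<lambda>x. if even x then g x else h x) V) ` ?B \<subseteq> ?A"
    proof
      fix c assume "c \<in> (\<lambda>(g, h). restrict (\<lambda>x. if even x then g x else h x) V) ` ?B"
      then obtain g h where g: "g \<in> ?E \<rightarrow>\<^sub>E Q"
        and h: "h \<in> (\<Pi>\<^sub>E a\<in>?O. Q - g ` {b\<in>V. even b \<and> a < b})"
        and c: "c = restrict (\<lambda>x. if even x then g x else h x) V" by auto
      have ha: "h a \<in> Q - g ` {b\<in>V. even b \<and> a < b}" if "a \<in> V" "odd a" for a
        using PiE_mem[OF h, of a] that by simp
      have "c x \<in> Q" if "x \<in> V" for x
        using that PiE_mem[OF g, of x] ha[of x] by (simp add: c)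
      moreover have "c a \<noteq> c b" if "a \<in> V" "b \<in> V" "odd a" "even b" "a < b" for a b
        using that ha[of a] by (auto simp: c)
      ultimately show "c \<in> ?A" unfolding proper by (auto simp: c)
    qed
  qed
  then have "card ?A = card ?B" by (rule bij_betw_same_card)
  also have "\<dots> = (\<Sum>g\<in>?E \<rightarrow>\<^sub>E Q. \<Prod>a\<in>?O. card (Q - g ` {b\<in>V. even b \<and> a < b}))"
    using V Q by (simp add: card_SigmaI finite_PiE card_PiE)
  finally show ?thesis .
qed

text \<open>The map is injective between finite sets of equal cardinality.\<close>

lemma bij_betw_map_PiE:
  assumes "distinct es" and Q: "finite Q"
  shows "bij_betw (\<lambda>g. map g es) (set es \<rightarrow>\<^sub>E Q) {xs. set xs \<subseteq> Q \<and> length xs = length es}"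
proof -
  have inj: "inj_on (\<lambda>g. map g es) (set es \<rightarrow>\<^sub>E Q)"
    by (rule inj_onI, erule (1) PiE_ext) simp
  have "(\<lambda>g. map g es) ` (set es \<rightarrow>\<^sub>E Q) = {xs. set xs \<subseteq> Q \<and> length xs = length es}"
  proof (rule card_subset_eq)
    show "finite {xs. set xs \<subseteq> Q \<and> length xs = length es}" by (rule finite_lists_length_eq[OF Q])
    show "(\<lambda>g. map g es) ` (set es \<rightarrow>\<^sub>E Q) \<subseteq> {xs. set xs \<subseteq> Q \<and> length xs = length es}" by auto
    show "card ((\<lambda>g. map g es) ` (set es \<rightarrow>\<^sub>E Q)) = card {xs. set xs \<subseteq> Q \<and> length xs = length es}"
      using assms by (simp add: card_image[OF inj] card_PiE card_lists_length_eq distinct_card)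
  qed
  with inj show ?thesis by (simp add: bij_betw_def)
qed

section \<open>Generating functions of weighted colour sequences\<close>

text \<open>The value at \<open>t = q\<close> is a sum over the sequences of \<open>n\<close> out of \<open>q\<close> colours with exactly \<open>j\<close> distinct
  entries, each prefix of positive length contributing the factor \<open>(q - d)\<^sup>k\<close>, where \<open>d\<close> counts the
  distinct entries of the prefix (\<open>sum_colour_weight\<close>). For \<open>k = 0\<close> it is the falling factorial \<open>(t)\<^sub>j\<close> times
  a Stirling number of the second kind.\<close>

primrec colour_seq_poly :: "nat \<Rightarrow> nat \<Rightarrow> nat \<Rightarrow> int poly" where
  "colour_seq_poly k 0 j = (if j = 0 then 1 else 0)"
| "colour_seq_poly k (Suc n) j = (tvar - of_nat j) ^ k *
     (of_nat j * colour_seq_poly k n j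
      + (if j = 0 then 0 else (tvar - of_nat (j - 1)) * colour_seq_poly k n (j - 1)))"

lemma colour_seq_poly_eq_0: "n < j \<Longrightarrow> colour_seq_poly k n j = 0"
  by (induction n arbitrary: j) auto

lemma colour_seq_poly_0: "n > 0 \<Longrightarrow> colour_seq_poly k n 0 = 0"
  by (cases n) auto

lemma falling_factorial_Suc: "falling_factorial x (Suc n) = falling_factorial x n * (x - of_nat n)"
  by (simp add: falling_factorial_def)

lemma falling_factorial_Suc_left: "falling_factorial x (Suc n) = x * falling_factorial (x - 1) n"
  unfolding falling_factorial_def prod.lessThan_Suc_shift by (simp add: algebra_simps)

definition colour_seq_fps :: "nat \<Rightarrow> nat \<Rightarrow> int poly fps" where
  "colour_seq_fps k j = Abs_fps (\<lambda>n. colour_seq_poly k n j)"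

lemma colour_seq_fps_0: "colour_seq_fps k 0 = 1"
  by (rule fps_ext) (auto simp: colour_seq_fps_def colour_seq_poly_0)

text \<open>The recursion of the coefficients, read as an identity of power series: the coefficient of \<open>u\<^bsup>n+1\<^esup>\<close>
  on both sides is a rearrangement of the recursion for \<open>n+1\<close> and \<open>j+1\<close>.\<close>

lemma colour_seq_fps_Suc:
  "colour_seq_fps k (Suc j) * (1 - fps_const (of_nat (Suc j) * (tvar - of_nat (Suc j)) ^ k) * fps_X)
    = fps_const ((tvar - of_nat (Suc j)) ^ k * (tvar - of_nat j)) * fps_X * colour_seq_fps k j"
    (is "?A * (1 - fps_const ?a * fps_X) = fps_const ?b * fps_X * ?B")
proof -
  have "?A = fps_const ?a * (fps_X * ?A) + fps_const ?b * (fps_X * ?B)"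
  proof (rule fps_ext)
    fix n
    show "fps_nth ?A n = fps_nth (fps_const ?a * (fps_X * ?A) + fps_const ?b * (fps_X * ?B)) n"
      by (cases n) (simp_all add: colour_seq_fps_def algebra_simps)
  qed
  then show ?thesis by (simp add: algebra_simps)
qed

lemma colour_seq_fps_prod:
  "colour_seq_fps k j * (\<Prod>i=1..j. 1 - fps_const (of_nat i * (tvar - of_nat i) ^ k) * fps_X)
    = fps_const (falling_factorial tvar j * falling_factorial (tvar - 1) j ^ k) * fps_X ^ j"
proof (induction j)
  case 0
  then show ?case by (simp add: colour_seq_fps_0 falling_factorial_def)
next
  case (Suc j)
  let ?d = "\<lambda>i. 1 - fps_const (of_nat i * (tvar - of_nat i) ^ k) * fps_X :: int poly fps"
  have "colour_seq_fps k (Suc j) * (\<Prod>i=1..Suc j. ?d i)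
      = (colour_seq_fps k (Suc j) * ?d (Suc j)) * (\<Prod>i=1..j. ?d i)"
    by (simp add: mult_ac)
  also have "\<dots> = fps_const ((tvar - of_nat (Suc j)) ^ k * (tvar - of_nat j)) * fps_X
      * (colour_seq_fps k j * (\<Prod>i=1..j. ?d i))"
    unfolding colour_seq_fps_Suc by (simp only: mult_ac)
  also have "\<dots> = fps_const ((tvar - of_nat (Suc j)) ^ k * (tvar - of_nat j)
        * (falling_factorial tvar j * falling_factorial (tvar - 1) j ^ k)) * fps_X ^ Suc j"
    unfolding Suc.IH by (simp add: mult_ac flip: fps_const_mult)
  also have "(tvar - of_nat (Suc j)) ^ k * (tvar - of_nat j)
        * (falling_factorial tvar j * falling_factorial (tvar - 1) j ^ k)
      = falling_factorial tvar (Suc j) * falling_factorial (tvar - 1) (Suc j) ^ k"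
    unfolding falling_factorial_Suc power_mult_distrib of_nat_Suc diff_diff_add by (simp only: mult_ac add_ac)
  finally show ?case .
qed

definition term_fps :: "nat \<Rightarrow> nat \<Rightarrow> int poly fps" where
  "term_fps k j = fps_const (falling_factorial (tvar - 1) (j - 1) * falling_factorial (tvar - 1) j ^ k)
      * fps_X ^ j * fps_recip (\<Prod>i=1..j. 1 - fps_const (of_nat i * (tvar - of_nat i) ^ k) * fps_X)"

lemma colour_seq_fps_closed_form:
  assumes "j > 0"
  shows "fps_const tvar * term_fps k j = colour_seq_fps k j"
proof -
  let ?D = "\<Prod>i=1..j. 1 - fps_const (of_nat i * (tvar - of_nat i) ^ k) * fps_X :: int poly fps"
  have D0: "fps_nth ?D 0 = 1" by (induction j) simp_all
  have "falling_factorial tvar j = tvar * falling_factorial (tvar - 1) (j - 1)"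
    using assms falling_factorial_Suc_left[of tvar "j - 1"] by simp
  then have "fps_const tvar * (fps_const (falling_factorial (tvar - 1) (j - 1) * falling_factorial (tvar - 1) j ^ k)
      * fps_X ^ j * fps_recip ?D)
    = fps_const (falling_factorial tvar j * falling_factorial (tvar - 1) j ^ k) * fps_X ^ j * fps_recip ?D"
    by (simp add: mult_ac flip: fps_const_mult)
  also have "\<dots> = colour_seq_fps k j * (?D * fps_recip ?D)"
    unfolding colour_seq_fps_prod[symmetric] by (simp only: mult_ac)
  also have "\<dots> = colour_seq_fps k j" by (simp only: fps_recip[OF D0] mult_1_right)
  finally show ?thesis unfolding term_fps_def .
qed

lemma tvar_neq_0: "tvar \<noteq> 0"
  by (simp add: monom_eq_0_iff)

lemma tvar_times_term_fps: "j > 0 \<Longrightarrow> tvar * fps_nth (term_fps k j) n = colour_seq_poly k n j"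
  using arg_cong[OF colour_seq_fps_closed_form[of j k], of "\<lambda>f. fps_nth f n"]
  by (simp only: fps_mult_left_const_nth colour_seq_fps_def fps_nth_Abs_fps)

lemma term_fps_nth_eq_0:
  assumes "n < j"
  shows "fps_nth (term_fps k j) n = 0"
proof -
  have "tvar * fps_nth (term_fps k j) n = 0"
    using assms by (simp only: tvar_times_term_fps colour_seq_poly_eq_0)
  with tvar_neq_0 show ?thesis by (simp only: mult_eq_0_iff simp_thms)
qed

section \<open>Summing the weights of colour sequences\<close>

definition colour_weight :: "nat \<Rightarrow> int \<Rightarrow> 'a list \<Rightarrow> int" where
  "colour_weight k q xs = (\<Prod>m=1..length xs. (q - int (card (set (take m xs)))) ^ k)"

lemma colour_weight_snoc:
  "colour_weight k q (xs @ [x]) = colour_weight k q xs * (q - int (card (insert x (set xs)))) ^ k"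
  by (simp add: colour_weight_def)

text \<open>A sequence of length \<open>n+1\<close> arises from one of length \<open>n\<close> by appending a colour. The result has \<open>j\<close>
  distinct colours if the colour is one of \<open>j\<close> colours already present, or one of \<open>q - (j - 1)\<close> colours
  absent from a sequence with \<open>j - 1\<close> distinct entries; either way the new prefix contributes the factor
  \<open>(q - j)\<^sup>k\<close>.\<close>

lemma sum_colour_weight:
  fixes Q :: "'a set"
  assumes Q: "finite Q"
  defines "q \<equiv> int (card Q)"
  shows "(\<Sum>xs | set xs \<subseteq> Q \<and> length xs = n. if card (set xs) = j then colour_weight k q xs else 0)
    = poly (colour_seq_poly k n j) q"
proof (induction n arbitrary: j)
  case 0
  have "{xs. set xs \<subseteq> Q \<and> length xs = 0} = {[]}" by auto
  then show ?case by (simp add: colour_weight_def)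
next
  case (Suc n)
  let ?L = "\<lambda>n. {xs. set xs \<subseteq> Q \<and> length xs = n}"
  let ?w = "colour_weight k q"
  have extend: "(\<Sum>x\<in>Q. if card (insert x (set xs)) = j then 1 else 0)
      = (if card (set xs) = j then int j else 0)
        + (if Suc (card (set xs)) = j then q - int (j - 1) else 0)" (is "?l = ?r")
    if xs: "xs \<in> ?L n" for xs
  proof -
    have sub: "set xs \<subseteq> Q" using xs by simp
    have "?l = (\<Sum>x\<in>set xs. if card (insert x (set xs)) = j then 1 else 0)
        + (\<Sum>x\<in>Q - set xs. if card (insert x (set xs)) = j then 1 else 0)"
      by (subst sum.subset_diff[OF sub Q]) (rule add.commute)
    moreover have "(\<Sum>x\<in>set xs. if card (insert x (set xs)) = j then 1 else 0)
        = (\<Sum>x\<in>set xs. if card (set xs) = j then 1 else 0 :: int)"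
      by (intro sum.cong refl) (simp add: insert_absorb)
    moreover have "(\<Sum>x\<in>Q - set xs. if card (insert x (set xs)) = j then 1 else 0)
        = (\<Sum>x\<in>Q - set xs. if Suc (card (set xs)) = j then 1 else 0 :: int)"
      by (intro sum.cong refl) simp
    moreover have "int (card (Q - set xs)) = q - int (card (set xs))"
      using card_Diff_subset[OF finite_set sub] card_mono[OF Q sub] by (simp add: q_def of_nat_diff)
    ultimately show ?thesis by auto
  qed
  have "(\<Sum>xs\<in>?L (Suc n). if card (set xs) = j then ?w xs else 0)
      = (\<Sum>(xs, x)\<in>?L n \<times> Q. if card (insert x (set xs)) = j then ?w (xs @ [x]) else 0)"
  proof (rule sum.reindex_bij_witness[where j = "\<lambda>ys. (butlast ys, last ys)" and i = "\<lambda>(xs, x). xs @ [x]"])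
    fix ys assume ys: "ys \<in> ?L (Suc n)"
    then have ne: "ys \<noteq> []" by auto
    then have dec: "butlast ys @ [last ys] = ys" by simp
    then have "set ys = insert (last ys) (set (butlast ys))" by (metis rotate1.simps(2) set_rotate1 list.simps(15))
    with ys ne dec show "(case (butlast ys, last ys) of (xs, x) \<Rightarrow> xs @ [x]) = ys"
      "(butlast ys, last ys) \<in> ?L n \<times> Q"
      "(case (butlast ys, last ys) of (xs, x) \<Rightarrow> if card (insert x (set xs)) = j then ?w (xs @ [x]) else 0)
        = (if card (set ys) = j then ?w ys else 0)"
      by auto
  qed auto
  also have "\<dots> = (\<Sum>xs\<in>?L n. \<Sum>x\<in>Q. if card (insert x (set xs)) = j then ?w (xs @ [x]) else 0)"
    by (simp add: sum.cartesian_product)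
  also have "\<dots> = (\<Sum>xs\<in>?L n. (q - int j) ^ k * (?w xs * (\<Sum>x\<in>Q. if card (insert x (set xs)) = j then 1 else 0)))"
    unfolding sum_distrib_left by (intro sum.cong refl) (auto simp: colour_weight_snoc)
  also have "\<dots> = (\<Sum>xs\<in>?L n. (q - int j) ^ k * (int j * (if card (set xs) = j then ?w xs else 0)
      + (if j = 0 then 0 else (q - int (j - 1)) * (if card (set xs) = j - 1 then ?w xs else 0))))"
    by (intro sum.cong refl) (subst extend, auto simp: algebra_simps)
  also have "\<dots> = (q - int j) ^ k * (int j * (\<Sum>xs\<in>?L n. if card (set xs) = j then ?w xs else 0)
      + (if j = 0 then 0 else (q - int (j - 1)) * (\<Sum>xs\<in>?L n. if card (set xs) = j - 1 then ?w xs else 0)))"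
    by (simp add: sum.distrib flip: sum_distrib_left)
  also have "\<dots> = poly (colour_seq_poly k (Suc n) j) q"
    unfolding Suc.IH by (simp add: poly_monom)
  finally show ?case .
qed

lemma sum_all_colour_weight:
  assumes Q: "finite Q"
  shows "(\<Sum>xs | set xs \<subseteq> Q \<and> length xs = n. colour_weight k (int (card Q)) xs)
    = (\<Sum>j\<le>n. poly (colour_seq_poly k n j) (int (card Q)))"
proof -
  have "(\<Sum>xs | set xs \<subseteq> Q \<and> length xs = n. colour_weight k (int (card Q)) xs)
      = (\<Sum>xs | set xs \<subseteq> Q \<and> length xs = n. \<Sum>j\<le>n. if card (set xs) = j then colour_weight k (int (card Q)) xs else 0)"
    by (intro sum.cong refl) (auto simp: card_length)
  also have "\<dots> = (\<Sum>j\<le>n. poly (colour_seq_poly k n j) (int (card Q)))"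
    unfolding sum_colour_weight[OF Q, symmetric] by (rule sum.swap)
  finally show ?thesis .
qed

section \<open>Vertex sets of staircase type\<close>

locale staircase_type =
  fixes k n :: nat and V :: "nat set"
  assumes finite_V: "finite V" and type_V: "partition_type V = staircase k n"
begin

text \<open>The evens are listed in decreasing order, so that the evens above a given vertex form a prefix.\<close>

definition evens :: "nat list" where
  "evens = rev (sorted_list_of_set {b \<in> V. even b})"

definition evens_above :: "nat \<Rightarrow> nat" where
  "evens_above a = length (takeWhile ((<) a) evens)"

lemma set_evens: "set evens = {b \<in> V. even b}"
  using finite_V by (simp add: evens_def)

lemma distinct_evens: "distinct evens"
  by (simp add: evens_def)

lemma staircase_counts: "map (\<lambda>b. card {a \<in> V. odd a \<and> a < b}) evens = staircase k n"
  using type_V by (simp add: partition_type_def evens_def rev_map)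

lemma length_evens: "length evens = n"
  using arg_cong[OF staircase_counts, of length] by (simp add: staircase_def)

lemma card_odds_below:
  assumes "m < n"
  shows "card {a \<in> V. odd a \<and> a < evens ! m} = (n - m) * k"
proof -
  have "card {a \<in> V. odd a \<and> a < evens ! m} = staircase k n ! m"
    using assms length_evens by (simp flip: staircase_counts)
  also have "\<dots> = (1 + (n - Suc m)) * k"
    using assms by (simp add: staircase_def rev_nth del: upt_Suc)
  also have "1 + (n - Suc m) = n - m" using assms by simp
  finally show ?thesis .
qed

lemma less_evens_above_iff:
  assumes "m < n"
  shows "m < evens_above a \<longleftrightarrow> a < evens ! m"
proof
  assume m: "m < evens_above a"
  then have "takeWhile ((<) a) evens ! m \<in> set (takeWhile ((<) a) evens)"
    by (simp add: evens_above_def)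
  moreover have "takeWhile ((<) a) evens ! m = evens ! m"
    using m by (simp add: evens_above_def takeWhile_nth)
  ultimately show "a < evens ! m" by (metis set_takeWhileD)
next
  assume a: "a < evens ! m"
  have "sorted (rev evens)" by (simp add: evens_def)
  then have "evens ! m \<le> evens ! i" if "i \<le> m" for i
    using that assms length_evens by (simp add: sorted_rev_nth_mono)
  then have "Suc m \<le> length (takeWhile ((<) a) evens)"
    using a assms length_evens
    by (intro length_takeWhile_less_P_nth) (auto intro: less_le_trans simp: less_Suc_eq_le)
  then show "m < evens_above a" by (simp add: evens_above_def)
qed

lemma evens_above_le: "evens_above a \<le> n"
  using length_takeWhile_le[of "(<) a" evens] by (simp add: evens_above_def length_evens)

lemma set_take_evens_above: "set (take (evens_above a) evens) = {b \<in> V. even b \<and> a < b}"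
proof
  have "take (evens_above a) evens = takeWhile ((<) a) evens"
    by (simp add: evens_above_def flip: takeWhile_eq_take)
  then show "set (take (evens_above a) evens) \<subseteq> {b \<in> V. even b \<and> a < b}"
    using set_evens by (auto dest: set_takeWhileD)
  show "{b \<in> V. even b \<and> a < b} \<subseteq> set (take (evens_above a) evens)"
  proof
    fix b assume b: "b \<in> {b \<in> V. even b \<and> a < b}"
    then obtain m where m: "m < n" "b = evens ! m"
      using set_evens length_evens by (metis (no_types, lifting) in_set_conv_nth mem_Collect_eq)
    then have "m < evens_above a" using b less_evens_above_iff by simp
    then show "b \<in> set (take (evens_above a) evens)"
      using m length_evens by (auto simp: in_set_conv_nth)
  qed
qed

lemma evens_above_eq_0: "{a \<in> V. odd a \<and> evens_above a = 0} = isolated_odds V"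
proof -
  have "evens_above a = 0 \<longleftrightarrow> {b \<in> V. even b \<and> a < b} = {}" for a
    using evens_above_le[of a] length_evens unfolding set_take_evens_above[symmetric] by auto
  then show ?thesis by (auto simp: isolated_odds_def)
qed

text \<open>The odd vertices below the \<open>i\<close>-th largest even number (counting from \<open>0\<close>) are those that see more than
  \<open>i\<close> evens, and there are \<open>(n - i) k\<close> of them; consecutive terms differ by \<open>k\<close>.\<close>

lemma card_evens_above_eq:
  assumes "m \<in> {1..n}"
  shows "card {a \<in> V. odd a \<and> evens_above a = m} = k"
proof -
  obtain i where i: "m = Suc i" "i < n" using assms by (cases m) auto
  let ?A = "\<lambda>i. {a \<in> V. odd a \<and> i < evens_above a}"
  have card_A: "card (?A i) = (n - i) * k" if "i \<le> n" for i
  proof (cases "i = n")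
    case True
    then have empty: "?A i = {}" using evens_above_le by (auto simp: not_less)
    show ?thesis unfolding empty using True by simp
  next
    case False
    then show ?thesis using that card_odds_below[of i] by (simp add: less_evens_above_iff)
  qed
  have "{a \<in> V. odd a \<and> evens_above a = m} = ?A i - ?A (Suc i)" using i by auto
  moreover have "card (?A i - ?A (Suc i)) = card (?A i) - card (?A (Suc i))"
    using finite_V by (intro card_Diff_subset) auto
  ultimately have "card {a \<in> V. odd a \<and> evens_above a = m} = card (?A i) - card (?A (Suc i))"
    by simp
  also have "\<dots> = (n - i) * k - (n - Suc i) * k" using card_A i by simp
  also have "\<dots> = k" using i by (simp flip: diff_mult_distrib)
  finally show ?thesis .
qed

lemma prod_over_odds:
  fixes F :: "nat \<Rightarrow> int"
  shows "(\<Prod>a\<in>{a\<in>V. odd a}. F (evens_above a)) = F 0 ^ card (isolated_odds V) * (\<Prod>m=1..n. F m ^ k)"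
proof -
  let ?O = "{a \<in> V. odd a}"
  have "(\<Prod>a\<in>?O. F (evens_above a)) = (\<Prod>m\<in>{0..n}. \<Prod>a\<in>{a \<in> ?O. evens_above a = m}. F (evens_above a))"
    using finite_V evens_above_le by (intro prod.group[symmetric]) auto
  also have "\<dots> = (\<Prod>m\<in>{0..n}. F m ^ card {a \<in> V. odd a \<and> evens_above a = m})"
    by (intro prod.cong refl) (simp add: conj_assoc)
  also have "\<dots> = F 0 ^ card (isolated_odds V) * (\<Prod>m=1..n. F m ^ card {a \<in> V. odd a \<and> evens_above a = m})"
    by (simp add: prod.atLeast_Suc_atMost evens_above_eq_0)
  also have "(\<Prod>m=1..n. F m ^ card {a \<in> V. odd a \<and> evens_above a = m}) = (\<Prod>m=1..n. F m ^ k)"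
    by (intro prod.cong refl) (simp only: card_evens_above_eq)
  finally show ?thesis .
qed

text \<open>Grouping the odd vertices by the number \<open>m\<close> of evens above them turns the product over odd vertices into
  the weight of the sequence of colours of the evens. The isolated vertices form the group \<open>m = 0\<close> and
  take any of the colours.\<close>

lemma card_proper_colourings:
  fixes Q :: "'a set"
  assumes Q: "finite Q"
  shows "int (card {c \<in> V \<rightarrow>\<^sub>E Q. proper_colouring V (Gamma_edges V) c})
    = int (card Q) ^ card (isolated_odds V) * (\<Sum>j\<le>n. poly (colour_seq_poly k n j) (int (card Q)))"
proof -
  let ?q = "int (card Q)" and ?E = "{b\<in>V. even b}" and ?O = "{a\<in>V. odd a}"
  have weight: "int (\<Prod>a\<in>?O. card (Q - g ` {b\<in>V. even b \<and> a < b}))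
      = ?q ^ card (isolated_odds V) * colour_weight k ?q (map g evens)" if g: "g \<in> ?E \<rightarrow>\<^sub>E Q" for g
  proof -
    have "int (card (Q - g ` {b\<in>V. even b \<and> a < b})) = ?q - int (card (set (take (evens_above a) (map g evens))))" for a
    proof -
      have eq: "g ` {b\<in>V. even b \<and> a < b} = set (take (evens_above a) (map g evens))"
        by (simp add: take_map set_take_evens_above)
      have sub: "g ` {b\<in>V. even b \<and> a < b} \<subseteq> Q" using g by auto
      show ?thesis
        using card_Diff_subset[OF finite_subset[OF sub Q] sub] card_mono[OF Q sub] by (simp add: eq of_nat_diff)
    qed
    then have "int (\<Prod>a\<in>?O. card (Q - g ` {b\<in>V. even b \<and> a < b}))
        = (\<Prod>a\<in>?O. ?q - int (card (set (take (evens_above a) (map g evens)))))" by simp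
    also have "\<dots> = ?q ^ card (isolated_odds V) * colour_weight k ?q (map g evens)"
      by (subst prod_over_odds) (simp add: colour_weight_def length_evens)
    finally show ?thesis .
  qed
  have "int (card {c \<in> V \<rightarrow>\<^sub>E Q. proper_colouring V (Gamma_edges V) c})
      = (\<Sum>g\<in>?E \<rightarrow>\<^sub>E Q. int (\<Prod>a\<in>?O. card (Q - g ` {b\<in>V. even b \<and> a < b})))"
    by (simp only: card_proper_colourings_Gamma[OF finite_V Q] of_nat_sum)
  also have "\<dots> = (\<Sum>g\<in>set evens \<rightarrow>\<^sub>E Q. ?q ^ card (isolated_odds V) * colour_weight k ?q (map g evens))"
    unfolding set_evens by (intro sum.cong refl weight)
  also have "\<dots> = (\<Sum>xs | set xs \<subseteq> Q \<and> length xs = n. ?q ^ card (isolated_odds V) * colour_weight k ?q xs)"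
    using bij_betw_map_PiE[OF distinct_evens Q]
    unfolding length_evens by (rule sum.reindex_bij_betw)
  also have "\<dots> = ?q ^ card (isolated_odds V) * (\<Sum>j\<le>n. poly (colour_seq_poly k n j) ?q)"
    unfolding sum_distrib_left[symmetric] sum_all_colour_weight[OF Q] ..
  finally show ?thesis .
qed

text \<open>Both sides agree at every positive integer \<open>q\<close>, hence as polynomials: multiplied by one factor \<open>q\<close> for
  each isolated odd vertex, each of them counts the proper colourings with \<open>q\<close> colours. The graph has
  one further component, which accounts for the remaining factor \<open>t\<close>.\<close>

lemma tvar_times_bond_char_poly:
  assumes k: "k \<ge> 1" and n: "n \<ge> 1"
  shows "tvar * bond_char_poly V (Gamma_edges V) = (\<Sum>j\<le>n. colour_seq_poly k n j)"
proof -
  let ?l = "tvar * bond_char_poly V (Gamma_edges V)" and ?r = "\<Sum>j\<le>n. colour_seq_poly k n j"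
  \<comment> \<open>As \<open>k \<ge> 1\<close>, there is an odd vertex below the smallest even one, hence below all of them.\<close>
  have lowest: "evens ! (n - 1) \<in> V" "even (evens ! (n - 1))"
    using set_evens length_evens n nth_mem[of "n - 1" evens] by auto
  have "card {a \<in> V. odd a \<and> a < evens ! (n - 1)} = k" using card_odds_below[of "n - 1"] n by simp
  then have "{a \<in> V. odd a \<and> a < evens ! (n - 1)} \<noteq> {}" using k by (metis card.empty not_one_le_zero)
  then obtain a where a: "a \<in> V" "odd a" "a < evens ! (n - 1)" by auto
  have below: "a < b" if "b \<in> V" "even b" for b
  proof -
    obtain m where m: "m < n" "b = evens ! m"
      using \<open>b \<in> V\<close> \<open>even b\<close> set_evens length_evens
      by (metis (no_types, lifting) in_set_conv_nth mem_Collect_eq)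
    have "n - 1 < evens_above a" using less_evens_above_iff[of "n - 1" a] n a by simp
    then have "m < evens_above a" using m by simp
    then show ?thesis using less_evens_above_iff m by simp
  qed
  obtain T where top: "T \<in> bond_lattice V (Gamma_edges V)"
      "\<And>X. X \<in> bond_lattice V (Gamma_edges V) \<Longrightarrow> (X, T) \<in> bond_order V (Gamma_edges V)"
      "card T = Suc (card (isolated_odds V))"
    using Gamma_top[OF finite_V lowest a(1,2) below] by blast
  have "poly ?l (int q) = poly ?r (int q)" if q: "q \<ge> 1" for q
  proof -
    let ?I = "card (isolated_odds V)"
    have "int q ^ Suc ?I * poly (bond_char_poly V (Gamma_edges V)) (int q)
        = int (card {c \<in> V \<rightarrow>\<^sub>E {..<q}. proper_colouring V (Gamma_edges V) c})"
      using bond_char_poly_counts_colourings[OF finite_V Gamma_edges_loopfree finite_lessThan[of q] top(1,2)]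
      unfolding top(3) card_lessThan .
    also have "\<dots> = int q ^ ?I * poly ?r (int q)"
      using card_proper_colourings[OF finite_lessThan[of q]] by (simp add: poly_sum)
    finally have "int q ^ ?I * poly ?l (int q) = int q ^ ?I * poly ?r (int q)"
      by (simp add: poly_monom mult_ac)
    then show ?thesis using q by simp
  qed
  then have "int ` {1..} \<subseteq> {x. poly (?l - ?r) x = 0}" by auto
  moreover have "infinite (int ` {1..})"
    using infinite_Ici[of "1::nat"] by (simp add: finite_image_iff)
  ultimately have "infinite {x. poly (?l - ?r) x = 0}" by (rule infinite_super)
  then have "?l - ?r = 0" using poly_roots_finite by blast
  then show ?thesis by simp
qed

end

section \<open>The generating function of the characteristic polynomials\<close>

lemma has_sum_fps_triangular:
  fixes F :: "nat \<Rightarrow> 'a::ab_group_add fps"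
  assumes F: "\<And>j n. n < j \<Longrightarrow> fps_nth (F j) n = 0"
    and S: "\<And>n. fps_nth S n = (\<Sum>j=1..n. fps_nth (F j) n)"
  shows "(F has_sum S) {1..}"
proof (rule has_sum_fpsI)
  have support: "{j \<in> {1..}. fps_nth (F j) n \<noteq> 0} \<subseteq> {1..n}" for n
    using F by (auto simp flip: not_less)
  then show "finite {j \<in> {1..}. fps_nth (F j) n \<noteq> 0}" for n
    by (rule finite_subset) simp
  show "fps_nth S n = (\<Sum>j | j \<in> {1..} \<and> fps_nth (F j) n \<noteq> 0. fps_nth (F j) n)" for n
    unfolding S using support[of n] by (intro sum.mono_neutral_right) auto
qed

lemma (in staircase_type) bond_char_poly_eq_term_sum:
  assumes k: "k \<ge> 1" and n: "n \<ge> 1"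
  shows "bond_char_poly V (Gamma_edges V) = (\<Sum>j=1..n. fps_nth (term_fps k j) n)"
proof -
  have "tvar * bond_char_poly V (Gamma_edges V) = (\<Sum>j\<le>n. colour_seq_poly k n j)"
    by (rule tvar_times_bond_char_poly[OF k n])
  also have "\<dots> = (\<Sum>j=1..n. colour_seq_poly k n j)"
    using n by (intro sum.mono_neutral_right) (auto simp: colour_seq_poly_0 not_le)
  also have "\<dots> = tvar * (\<Sum>j=1..n. fps_nth (term_fps k j) n)"
    unfolding sum_distrib_left by (intro sum.cong refl tvar_times_term_fps[symmetric]) simp
  finally show ?thesis using tvar_neq_0 by (simp only: mult_cancel_left simp_thms)
qed

theorem theorem5p1:
  fixes k :: nat and V :: "nat \<Rightarrow> nat set"
  assumes "k \<ge> 1"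
    and "\<And>n. n \<ge> 1 \<Longrightarrow> finite (V n)"
    and "\<And>n. n \<ge> 1 \<Longrightarrow> V n \<subseteq> {0<..}"
    and "\<And>n. n \<ge> 1 \<Longrightarrow> partition_type (V n) = staircase k n"
  shows "((\<lambda>n. fps_const (falling_factorial (tvar - 1) (n - 1) * falling_factorial (tvar - 1) n ^ k)
              * fps_X ^ n
              * fps_recip (\<Prod>i=1..n. 1 - fps_const (of_nat i * (tvar - of_nat i) ^ k) * fps_X))
          has_sum
          Abs_fps (\<lambda>n. if n = 0 then 0 else bond_char_poly (V n) (Gamma_edges (V n)))) {1..}"
  unfolding term_fps_def[symmetric]
proof (rule has_sum_fps_triangular)
  show "fps_nth (term_fps k j) n = 0" if "n < j" for j n
    using that by (rule term_fps_nth_eq_0)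
  show "fps_nth (Abs_fps (\<lambda>n. if n = 0 then 0 else bond_char_poly (V n) (Gamma_edges (V n)))) n
      = (\<Sum>j=1..n. fps_nth (term_fps k j) n)" for n
  proof (cases "n = 0")
    case False
    then interpret staircase_type k n "V n"
      using assms by unfold_locales auto
    show ?thesis
      using False bond_char_poly_eq_term_sum assms(1) by simp
  qed simp
qed

end
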